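(* For any $A,B\in\widehat{\mathbb Q}^{m\times n}$, with $s=\min\{m,n\}$, it holds that $$\mathrm{trace}(A^*B+B^*A)\le 2\sum_{i=1}^s\sigma_i(A)\sigma_i(B),$$ where $\sigma_1(A)\ge\sigma_2(A)\ge\cdots\ge\sigma_s(A)$ and $\sigma_1(B)\ge\sigma_2(B)\ge\cdots\ge\sigma_s(B)$ are the singular values of $A$ and $B$, respectively, and $\le$ is the total order on dual numbers.
   Context: Dual numbers: $\widehat{\mathbb R}=\{q_{\sf st}+q_{\sf in}\epsilon: q_{\sf st},q_{\sf in}\in\mathbb R\}$ with $\epsilon\neq 0$, $\epsilon^2=0$, is a commutative ring, totally ordered by: $q<p$ iff $q_{\sf st}<p_{\sf st}$, or $q_{\sf st}=p_{\sf st}$ and $q_{\sf in}<p_{\sf in}$. A dual number is positive if it is $>0$. Dual quaternions: let $\mathbb Q$ be the real quaternions. $\widehat{\mathbb Q}=\{q_{\sf st}+q_{\sf in}\epsilon: q_{\sf st},q_{\sf in}\in\mathbb Q\}$, where $\epsilon$ commutes with quaternions and $\epsilon^2=0$. The conjugate is $\bar q=\bar q_{\sf st}+\bar q_{\sf in}\epsilon$ (quaternion conjugation in each part). A dual number or dual quaternion $q$ is appreciable if $q_{\sf st}\ne 0$, and infinitesimal otherwise. Matrices: $\widehat{\mathbb Q}^{m\times n}$ is the set of $m\times n$ matrices over $\widehat{\mathbb Q}$. For $A=(a_{ij})$, $A^*=(\bar a_{ji})$ is the conjugate transpose. A square matrix $U$ is unitary if $U^*U=UU^*=I$; $A$ is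 Hermitian if $A^*=A$. For a square matrix, $\mathrm{trace}(A)=\sum_i a_{ii}$. The diagonal entries of a Hermitian matrix such as $A^*B+B^*A$ are dual numbers, so its trace is a dual number. Singular values: it is known that for every $A\in\widehat{\mathbb Q}^{m\times n}$ there are unitary $U\in\widehat{\mathbb Q}^{m\times m}$, $V\in\widehat{\mathbb Q}^{n\times n}$ such that $A=U\Sigma V^*$, where $\Sigma$ is the $m\times n$ diagonal matrix with diagonal entries $\sigma_1(A)\ge\cdots\ge\sigma_s(A)\ge 0$ in $\widehat{\mathbb R}$, $s=\min\{m,n\}$ (first positive appreciable ones, then positive infinitesimal ones, then possibly zeros), and these entries are uniquely determined by $A$ (with multiplicity). They are the singular values of $A$. *)

theory Defs
  imports Complex_Main "Jordan_Normal_Form.Matrix"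
begin

section \<open>Dual numbers over an arbitrary coefficient ring\<close>

text \<open>
  \<open>Dual a b\<close> stands for $a + b\epsilon$ with $\epsilon^2 = 0$ and $\epsilon$ central.  The dual
  numbers are \<open>real dual\<close> and the dual quaternions are \<open>quat dual\<close>.
\<close>

datatype 'a dual = Dual (st_part: 'a) (in_part: 'a)

lemma dual_eq_iff: "p = q \<longleftrightarrow> st_part p = st_part q \<and> in_part p = in_part q"
  by (cases p; cases q) auto

instantiation dual :: (ring_1) ring_1
begin

definition zero_dual :: "'a dual" where "0 = Dual 0 0"
definition one_dual :: "'a dual" where "1 = Dual 1 0"
definition plus_dual :: "'a dual \<Rightarrow> 'a dual \<Rightarrow> 'a dual" where
  "p + q = Dual (st_part p + st_part q) (in_part p + in_part q)"
definition minus_dual :: "'a dual \<Rightarrow> 'a dual \<Rightarrow> 'a dual" where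
  "p - q = Dual (st_part p - st_part q) (in_part p - in_part q)"
definition uminus_dual :: "'a dual \<Rightarrow> 'a dual" where
  "- p = Dual (- st_part p) (- in_part p)"
definition times_dual :: "'a dual \<Rightarrow> 'a dual \<Rightarrow> 'a dual" where
  "p * q = Dual (st_part p * st_part q) (st_part p * in_part q + in_part p * st_part q)"

instance
  by standard
    (simp_all add: dual_eq_iff zero_dual_def one_dual_def plus_dual_def minus_dual_def
      uminus_dual_def times_dual_def algebra_simps)

end

instance dual :: (comm_ring_1) comm_ring_1
  by standard (simp_all add: dual_eq_iff times_dual_def one_dual_def plus_dual_def algebra_simps)

instantiation dual :: (linorder) linorder
begin

definition less_dual :: "'a dual \<Rightarrow> 'a dual \<Rightarrow> bool" where
  "p < q \<longleftrightarrow> st_part p < st_part q \<or> (st_part p = st_part q \<and> in_part p < in_part q)"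
definition less_eq_dual :: "'a dual \<Rightarrow> 'a dual \<Rightarrow> bool" where
  "(p :: 'a dual) \<le> q \<longleftrightarrow> p < q \<or> p = q"

instance
  by standard (auto simp: less_eq_dual_def less_dual_def dual_eq_iff)

end


section \<open>Quaternions\<close>

datatype quat = Quat (qre: real) (qi: real) (qj: real) (qk: real)

lemma quat_eq_iff:
  "x = y \<longleftrightarrow> qre x = qre y \<and> qi x = qi y \<and> qj x = qj y \<and> qk x = qk y"
  by (cases x; cases y) auto

instantiation quat :: real_algebra_1
begin

definition zero_quat :: quat where "0 = Quat 0 0 0 0"
definition one_quat :: quat where "1 = Quat 1 0 0 0"
definition plus_quat :: "quat \<Rightarrow> quat \<Rightarrow> quat" where
  "x + y = Quat (qre x + qre y) (qi x + qi y) (qj x + qj y) (qk x + qk y)"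
definition minus_quat :: "quat \<Rightarrow> quat \<Rightarrow> quat" where
  "x - y = Quat (qre x - qre y) (qi x - qi y) (qj x - qj y) (qk x - qk y)"
definition uminus_quat :: "quat \<Rightarrow> quat" where
  "- x = Quat (- qre x) (- qi x) (- qj x) (- qk x)"
definition scaleR_quat :: "real \<Rightarrow> quat \<Rightarrow> quat" where
  "scaleR r x = Quat (r * qre x) (r * qi x) (r * qj x) (r * qk x)"
definition times_quat :: "quat \<Rightarrow> quat \<Rightarrow> quat" where
  "x * y = Quat
     (qre x * qre y - qi x * qi y - qj x * qj y - qk x * qk y)
     (qre x * qi y + qi x * qre y + qj x * qk y - qk x * qj y)
     (qre x * qj y - qi x * qk y + qj x * qre y + qk x * qi y)
     (qre x * qk y + qi x * qj y - qj x * qi y + qk x * qre y)"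

instance
  by standard
    (simp_all add: quat_eq_iff zero_quat_def one_quat_def plus_quat_def minus_quat_def
      uminus_quat_def scaleR_quat_def times_quat_def algebra_simps)

end

definition quat_cnj :: "quat \<Rightarrow> quat" where
  "quat_cnj x = Quat (qre x) (- qi x) (- qj x) (- qk x)"


section \<open>Dual quaternion matrices\<close>

definition dq_cnj :: "quat dual \<Rightarrow> quat dual" where
  "dq_cnj = map_dual quat_cnj"

definition dq_of_dual :: "real dual \<Rightarrow> quat dual" where
  "dq_of_dual = map_dual of_real"

definition ctranspose :: "quat dual mat \<Rightarrow> quat dual mat" where
  "ctranspose A = map_mat dq_cnj (transpose_mat A)"

definition mat_trace :: "'a :: comm_monoid_add mat \<Rightarrow> 'a" where
  "mat_trace A = (\<Sum>i<dim_row A. A $$ (i, i))"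

definition unitary_dqmat :: "nat \<Rightarrow> quat dual mat \<Rightarrow> bool" where
  "unitary_dqmat n U \<longleftrightarrow>
     U \<in> carrier_mat n n \<and> ctranspose U * U = 1\<^sub>m n \<and> U * ctranspose U = 1\<^sub>m n"

definition dq_diag :: "nat \<Rightarrow> nat \<Rightarrow> (nat \<Rightarrow> real dual) \<Rightarrow> quat dual mat" where
  "dq_diag m n \<sigma> = mat m n (\<lambda>(i, j). if i = j then dq_of_dual (\<sigma> i) else 0)"

text \<open>
  \<open>\<sigma> 0, ..., \<sigma> (min m n - 1)\<close> are the singular values $\sigma_1(A), \dots, \sigma_s(A)$ of the
  $m \times n$ matrix \<open>A\<close>; values of \<open>\<sigma>\<close> beyond that range are irrelevant.  That the positive
  appreciable values come first, then the positive infinitesimal ones, then the zeros, is a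
  consequence of being nonincreasing and nonnegative in the total order on \<open>real dual\<close>.
\<close>

definition singular_values :: "quat dual mat \<Rightarrow> (nat \<Rightarrow> real dual) \<Rightarrow> bool" where
  "singular_values A \<sigma> \<longleftrightarrow>
     (\<forall>i < min (dim_row A) (dim_col A). 0 \<le> \<sigma> i) \<and>
     (\<forall>i j. i \<le> j \<longrightarrow> j < min (dim_row A) (dim_col A) \<longrightarrow> \<sigma> j \<le> \<sigma> i) \<and>
     (\<exists>U V. unitary_dqmat (dim_row A) U \<and> unitary_dqmat (dim_col A) V \<and>
        A = U * dq_diag (dim_row A) (dim_col A) \<sigma> * ctranspose V)"

end

theory Submission
  imports Defs
begin

text \<open>
  This is von Neumann's trace inequality, and the classical argument with doubly stochastic
  matrices survives over the dual numbers because they form an \<^emph>\<open>ordered\<close> commutative ring: the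
  product of nonnegative dual numbers is nonnegative, although \<open>\<epsilon> * \<epsilon> = 0\<close> shows that
  strict positivity is not preserved.  Once this and the nonnegativity of squared moduli
  (\<open>dq_norm2_nonneg\<close>) are known, standard and infinitesimal parts need no separate treatment.

  Write \<open>A = U \<Sigma> V\<^sup>*\<close> and \<open>B = P \<Gamma> Q\<^sup>*\<close>.  The trace in question is twice the real part of
  \<open>trace (A\<^sup>* B)\<close>, and the real part of a trace is invariant under cyclic permutation even though
  quaternions do not commute.  With the unitary matrices \<open>W = U\<^sup>* P\<close> and \<open>Z = Q\<^sup>* V\<close> it becomes
  the sum of \<open>\<sigma>\<^sub>i \<gamma>\<^sub>j * 2 Re (W\<^sub>i\<^sub>j Z\<^sub>j\<^sub>i)\<close> over \<open>i, j < min m n\<close>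
  (\<open>re_trace_product_of_diagonals\<close>).  Nonnegativity of the squared modulus of
  \<open>W\<^sub>i\<^sub>j\<close> minus the conjugate of \<open>Z\<^sub>j\<^sub>i\<close> bounds
  \<open>2 Re (W\<^sub>i\<^sub>j Z\<^sub>j\<^sub>i)\<close> by the sum of the two squared moduli (\<open>two_re_mult_le\<close>).  The squared
  moduli of the entries of a unitary matrix have row and column sums \<open>1\<close>, and for nonincreasing
  nonnegative \<open>\<sigma>\<close> and \<open>\<gamma>\<close> such weights can make the bilinear form no larger than the diagonal
  sum of \<open>\<sigma>\<^sub>i \<gamma>\<^sub>i\<close> (\<open>substochastic_form_le\<close>), by summation by parts in both indices.
\<close>

section \<open>The ordered ring of dual numbers\<close>

instance dual :: (linordered_idom) ordered_comm_ring
proof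
  fix a b c :: "'a dual"
  show "a \<le> b \<Longrightarrow> c + a \<le> c + b"
    by (auto simp: less_eq_dual_def less_dual_def dual_eq_iff plus_dual_def)
  show "c * a \<le> c * b" if ab: "a \<le> b" and c: "0 \<le> c"
  proof (cases "st_part c = 0")
    \<comment> \<open>An infinitesimal factor annihilates the infinitesimal parts, and only the weak order of the
       standard parts remains; this is where strictness is lost.\<close>
    case True
    have "0 \<le> in_part c" and "st_part a \<le> st_part b"
      using ab c True by (auto simp: less_eq_dual_def less_dual_def zero_dual_def)
    then have "in_part c * st_part a \<le> in_part c * st_part b"
      by (intro mult_left_mono)
    with True show ?thesis
      by (auto simp: less_eq_dual_def less_dual_def dual_eq_iff times_dual_def)
  next
    case False
    then have "0 < st_part c"
      using c by (auto simp: less_eq_dual_def less_dual_def zero_dual_def)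
    with ab show ?thesis
      by (auto simp: less_eq_dual_def less_dual_def times_dual_def)
  qed
qed

section \<open>Bilinear forms in nonincreasing sequences\<close>

text \<open>
  Summation by parts, kept in a form without subtraction: moving the last weight \<open>x n\<close> down to
  all earlier terms only decreases the sum, as the partial sums of \<open>d\<close> are nonnegative.
\<close>

lemma decreasing_weighted_sum_ge:
  fixes x d :: "nat \<Rightarrow> 'a :: ordered_comm_ring"
  assumes "\<And>i. i < n \<Longrightarrow> x (Suc i) \<le> x i"
    and "\<And>k. k \<le> Suc n \<Longrightarrow> 0 \<le> (\<Sum>i<k. d i)"
  shows "x n * (\<Sum>i<Suc n. d i) \<le> (\<Sum>i<Suc n. x i * d i)"
  using assms
proof (induction n)
  case 0
  then show ?case by simp
next
  case (Suc n)
  have "x (Suc n) * (\<Sum>i<Suc n. d i) \<le> x n * (\<Sum>i<Suc n. d i)"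
    using Suc.prems(1)[of n] Suc.prems(2)[of "Suc n"] by (intro mult_right_mono) auto
  also have "\<dots> \<le> (\<Sum>i<Suc n. x i * d i)"
    using Suc.prems by (intro Suc.IH) auto
  finally have "x (Suc n) * (\<Sum>i<Suc n. d i) + x (Suc n) * d (Suc n)
      \<le> (\<Sum>i<Suc n. x i * d i) + x (Suc n) * d (Suc n)"
    by (rule add_right_mono)
  then show ?case
    by (simp add: distrib_left)
qed

lemma decreasing_weighted_sum_nonneg:
  fixes x d :: "nat \<Rightarrow> 'a :: ordered_comm_ring"
  assumes "\<And>i. i < n \<Longrightarrow> 0 \<le> x i"
    and "\<And>i. Suc i < n \<Longrightarrow> x (Suc i) \<le> x i"
    and "\<And>k. k \<le> n \<Longrightarrow> 0 \<le> (\<Sum>i<k. d i)"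
  shows "0 \<le> (\<Sum>i<n. x i * d i)"
proof (cases n)
  case 0
  then show ?thesis by simp
next
  case (Suc n')
  have "0 \<le> x n' * (\<Sum>i<Suc n'. d i)"
    using assms(1)[of n'] assms(3)[of "Suc n'"] Suc by (intro mult_nonneg_nonneg) auto
  also have "\<dots> \<le> (\<Sum>i<Suc n'. x i * d i)"
    using assms Suc by (intro decreasing_weighted_sum_ge) auto
  finally show ?thesis
    using Suc by simp
qed

text \<open>
  Products of indicator functions of initial segments generate the cone of the weights
  \<open>x i * y j\<close>, so nonnegativity needs to be tested on leading blocks only.  The proof applies the
  one-dimensional statement first in \<open>j\<close> and then in \<open>i\<close>.
\<close>

lemma decreasing_bilinear_form_nonneg:
  fixes x y :: "nat \<Rightarrow> 'a :: ordered_comm_ring"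
  assumes x: "\<And>i. i < n \<Longrightarrow> 0 \<le> x i" "\<And>i. Suc i < n \<Longrightarrow> x (Suc i) \<le> x i"
    and y: "\<And>i. i < n \<Longrightarrow> 0 \<le> y i" "\<And>i. Suc i < n \<Longrightarrow> y (Suc i) \<le> y i"
    and D: "\<And>k l. k \<le> n \<Longrightarrow> l \<le> n \<Longrightarrow> 0 \<le> (\<Sum>i<k. \<Sum>j<l. D i j)"
  shows "0 \<le> (\<Sum>i<n. \<Sum>j<n. x i * y j * D i j)"
proof -
  have "0 \<le> (\<Sum>i<n. x i * (\<Sum>j<n. y j * D i j))"
  proof (rule decreasing_weighted_sum_nonneg[where x = x, OF x])
    fix k assume k: "k \<le> n"
    have "0 \<le> (\<Sum>j<n. y j * (\<Sum>i<k. D i j))"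
    proof (rule decreasing_weighted_sum_nonneg[where x = y, OF y])
      fix l assume "l \<le> n"
      with D[OF k this] show "0 \<le> (\<Sum>j<l. \<Sum>i<k. D i j)"
        by (subst sum.swap)
    qed
    also have "\<dots> = (\<Sum>i<k. \<Sum>j<n. y j * D i j)"
      by (subst sum.swap) (simp add: sum_distrib_left)
    finally show "0 \<le> (\<Sum>i<k. \<Sum>j<n. y j * D i j)" .
  qed
  then show ?thesis
    by (simp add: sum_distrib_left mult.assoc)
qed

text \<open>
  A \<open>k \<times> l\<close> leading block of a doubly substochastic matrix has total weight at most
  \<open>min k l\<close>, by counting along its shorter side; the identity matrix attains this for all leading
  blocks at once.
\<close>

lemma substochastic_form_le:
  fixes x y :: "nat \<Rightarrow> 'a :: {ordered_comm_ring, comm_ring_1}"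
  assumes x: "\<And>i. i < n \<Longrightarrow> 0 \<le> x i" "\<And>i. Suc i < n \<Longrightarrow> x (Suc i) \<le> x i"
    and y: "\<And>i. i < n \<Longrightarrow> 0 \<le> y i" "\<And>i. Suc i < n \<Longrightarrow> y (Suc i) \<le> y i"
    and nonneg: "\<And>i j. i < n \<Longrightarrow> j < n \<Longrightarrow> 0 \<le> S i j"
    and rows: "\<And>i. i < n \<Longrightarrow> (\<Sum>j<n. S i j) \<le> 1"
    and cols: "\<And>j. j < n \<Longrightarrow> (\<Sum>i<n. S i j) \<le> 1"
  shows "(\<Sum>i<n. \<Sum>j<n. x i * y j * S i j) \<le> (\<Sum>i<n. x i * y i)"
proof -
  define D where "D i j = (if i = j then 1 else 0) - S i j" for i j
  have block: "0 \<le> (\<Sum>i<k. \<Sum>j<l. D i j)" if kl: "k \<le> n" "l \<le> n" for k l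
  proof (cases "k \<le> l")
    case True
    have "0 \<le> (\<Sum>j<l. D i j)" if "i < k" for i
    proof -
      have "(\<Sum>j<l. S i j) \<le> (\<Sum>j<n. S i j)"
        using kl that nonneg by (intro sum_mono2) auto
      also have "\<dots> \<le> 1"
        using rows kl that by simp
      finally show ?thesis
        using that True by (simp add: D_def sum_subtractf)
    qed
    then show ?thesis
      by (auto intro: sum_nonneg)
  next
    case False
    have "0 \<le> (\<Sum>i<k. D i j)" if "j < l" for j
    proof -
      have "(\<Sum>i<k. S i j) \<le> (\<Sum>i<n. S i j)"
        using kl that nonneg by (intro sum_mono2) auto
      also have "\<dots> \<le> 1"
        using cols kl that by simp
      finally show ?thesis
        using that False by (simp add: D_def sum_subtractf)
    qed
    then show ?thesis
      by (subst sum.swap) (auto intro: sum_nonneg)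
  qed
  have "0 \<le> (\<Sum>i<n. \<Sum>j<n. x i * y j * D i j)"
    by (rule decreasing_bilinear_form_nonneg[where x = x and y = y and D = D, OF x y block])
  also have "\<dots> = (\<Sum>i<n. \<Sum>j<n. x i * y j * (if i = j then 1 else 0))
      - (\<Sum>i<n. \<Sum>j<n. x i * y j * S i j)"
    by (simp only: D_def right_diff_distrib sum_subtractf)
  also have "(\<Sum>i<n. \<Sum>j<n. x i * y j * (if i = j then 1 else 0)) = (\<Sum>i<n. x i * y i)"
    by (simp add: if_distrib cong: if_cong)
  finally show ?thesis
    by simp
qed

section \<open>Real parts and squared moduli of dual quaternions\<close>

definition dq_re :: "quat dual \<Rightarrow> real dual" where
  "dq_re = map_dual qre"

definition dq_norm2 :: "quat dual \<Rightarrow> real dual" where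
  "dq_norm2 q = dq_re (q * dq_cnj q)"

lemma st_part_map_dual [simp]: "st_part (map_dual f q) = f (st_part q)"
  and in_part_map_dual [simp]: "in_part (map_dual f q) = f (in_part q)"
  by (cases q; simp)+

lemma quat_of_real: "(of_real r :: quat) = Quat r 0 0 0"
  by (simp add: of_real_def scaleR_quat_def one_quat_def)

lemmas quat_dual_defs = dq_re_def dq_cnj_def dq_of_dual_def dual_eq_iff quat_eq_iff quat_cnj_def
  quat_of_real zero_dual_def one_dual_def plus_dual_def minus_dual_def times_dual_def
  zero_quat_def one_quat_def plus_quat_def minus_quat_def times_quat_def

lemma dq_re_0 [simp]: "dq_re 0 = 0"
  and dq_re_1 [simp]: "dq_re 1 = 1"
  and dq_re_add: "dq_re (p + q) = dq_re p + dq_re q"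
  and dq_re_mult_commute: "dq_re (p * q) = dq_re (q * p)"
  and dq_re_scale: "dq_re (dq_of_dual r * q) = r * dq_re q"
  and dq_cnj_0 [simp]: "dq_cnj 0 = 0"
  and dq_cnj_add: "dq_cnj (p + q) = dq_cnj p + dq_cnj q"
  and dq_cnj_mult: "dq_cnj (p * q) = dq_cnj q * dq_cnj p"
  and dq_cnj_cnj [simp]: "dq_cnj (dq_cnj q) = q"
  and dq_cnj_of_dual [simp]: "dq_cnj (dq_of_dual r) = dq_of_dual r"
  and dq_of_dual_commute: "q * dq_of_dual r = dq_of_dual r * q"
  and dq_add_cnj: "q + dq_cnj q = dq_of_dual (dq_re q + dq_re q)"
  by (simp_all add: quat_dual_defs algebra_simps)

lemma dq_re_sum: "dq_re (sum f I) = (\<Sum>i\<in>I. dq_re (f i))"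
  by (induction I rule: infinite_finite_induct) (auto simp: dq_re_add)

lemma dq_cnj_sum: "dq_cnj (sum f I) = (\<Sum>i\<in>I. dq_cnj (f i))"
  by (induction I rule: infinite_finite_induct) (auto simp: dq_cnj_add)

lemma dq_norm2_cnj: "dq_norm2 (dq_cnj q) = dq_norm2 q"
  by (simp add: dq_norm2_def dq_re_mult_commute)

text \<open>
  The standard part is the squared modulus of the standard part of \<open>q\<close>.  The infinitesimal part
  has no definite sign, but it is an inner product with the standard part of \<open>q\<close>, so it vanishes
  whenever the standard part of the result does.
\<close>

lemma dq_norm2_nonneg: "0 \<le> dq_norm2 q"
proof -
  obtain a b c d r where q: "q = Dual (Quat a b c d) r"
    by (metis dual.exhaust quat.exhaust)
  have st: "st_part (dq_norm2 q) = a\<^sup>2 + b\<^sup>2 + c\<^sup>2 + d\<^sup>2"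
    by (simp add: q dq_norm2_def quat_dual_defs power2_eq_square)
  show ?thesis
  proof (cases "a = 0 \<and> b = 0 \<and> c = 0 \<and> d = 0")
    case True
    then have "dq_norm2 q = 0"
      by (simp add: q dq_norm2_def quat_dual_defs)
    then show ?thesis by simp
  next
    case False
    then have "0 < a\<^sup>2 + b\<^sup>2 + c\<^sup>2 + d\<^sup>2"
      by (smt (verit) zero_less_power2 zero_le_power2)
    then have "0 < dq_norm2 q"
      unfolding less_dual_def st by (simp add: zero_dual_def)
    then show ?thesis by simp
  qed
qed

text \<open>Expand the squared modulus of \<open>w\<close> minus the conjugate of \<open>z\<close>.\<close>

lemma two_re_mult_le: "dq_re (w * z) + dq_re (w * z) \<le> dq_norm2 w + dq_norm2 z"
proof -
  have "dq_norm2 (w - dq_cnj z) = dq_norm2 w + dq_norm2 z - (dq_re (w * z) + dq_re (w * z))"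
    by (simp add: dq_norm2_def quat_dual_defs algebra_simps)
  with dq_norm2_nonneg[of "w - dq_cnj z"] show ?thesis
    by simp
qed

section \<open>Conjugate transposes, traces and unitary matrices\<close>

lemma ctranspose_carrier [simp, intro]:
  "A \<in> carrier_mat m n \<Longrightarrow> ctranspose A \<in> carrier_mat n m"
  by (simp add: ctranspose_def)

lemma ctranspose_index [simp]:
  "A \<in> carrier_mat m n \<Longrightarrow> i < n \<Longrightarrow> j < m \<Longrightarrow> ctranspose A $$ (i, j) = dq_cnj (A $$ (j, i))"
  by (simp add: ctranspose_def)

lemma ctranspose_ctranspose [simp]: "ctranspose (ctranspose A) = A"
  by (rule eq_matI) (auto simp: ctranspose_def)

lemma mult_mat_index:
  "X \<in> carrier_mat m n \<Longrightarrow> Y \<in> carrier_mat n k \<Longrightarrow> i < m \<Longrightarrow> j < k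
    \<Longrightarrow> (X * Y) $$ (i, j) = (\<Sum>l<n. X $$ (i, l) * Y $$ (l, j))"
  by (simp add: scalar_prod_def lessThan_atLeast0)

lemma ctranspose_mult:
  assumes X: "X \<in> carrier_mat m n" and Y: "Y \<in> carrier_mat n k"
  shows "ctranspose (X * Y) = ctranspose Y * ctranspose X"
proof (rule eq_matI)
  note [simp] = ctranspose_carrier[OF X] ctranspose_carrier[OF Y]
  fix i j assume "i < dim_row (ctranspose Y * ctranspose X)"
    and "j < dim_col (ctranspose Y * ctranspose X)"
  then have ij: "i < k" "j < m"
    using ctranspose_carrier[OF X] ctranspose_carrier[OF Y] by auto
  have "ctranspose (X * Y) $$ (i, j) = dq_cnj ((X * Y) $$ (j, i))"
    using X Y ij by (intro ctranspose_index[of _ m k]) auto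
  also have "\<dots> = (\<Sum>l<n. dq_cnj (Y $$ (l, i)) * dq_cnj (X $$ (j, l)))"
    using ij by (simp add: mult_mat_index[OF X Y] dq_cnj_sum dq_cnj_mult del: index_mult_mat)
  also have "\<dots> = (ctranspose Y * ctranspose X) $$ (i, j)"
    using ij X Y
    by (simp add: mult_mat_index[OF ctranspose_carrier[OF Y] ctranspose_carrier[OF X]]
        del: index_mult_mat)
  finally show "ctranspose (X * Y) $$ (i, j) = (ctranspose Y * ctranspose X) $$ (i, j)" .
qed (use X Y in \<open>auto simp: ctranspose_def\<close>)

lemma mat_trace_mult:
  assumes X: "X \<in> carrier_mat m n" and Y: "Y \<in> carrier_mat n m"
  shows "mat_trace (X * Y) = (\<Sum>i<m. \<Sum>j<n. X $$ (i, j) * Y $$ (j, i))"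
  using X by (simp add: mat_trace_def mult_mat_index[OF X Y] del: index_mult_mat(1))

lemma re_trace_commute:
  assumes "X \<in> carrier_mat m n" and "Y \<in> carrier_mat n m"
  shows "dq_re (mat_trace (X * Y)) = dq_re (mat_trace (Y * X))"
  unfolding mat_trace_mult[OF assms] mat_trace_mult[OF assms(2,1)] dq_re_sum
  by (subst sum.swap) (simp add: dq_re_mult_commute)

lemma trace_add_ctranspose:
  assumes X: "X \<in> carrier_mat n n"
  shows "mat_trace (X + ctranspose X) = dq_of_dual (dq_re (mat_trace X) + dq_re (mat_trace X))"
proof -
  have "mat_trace (X + ctranspose X) = (\<Sum>i<n. X $$ (i, i)) + (\<Sum>i<n. dq_cnj (X $$ (i, i)))"
    using X carrier_matD[OF ctranspose_carrier[OF X]] by (simp add: mat_trace_def sum.distrib)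
  also have "\<dots> = mat_trace X + dq_cnj (mat_trace X)"
    using X by (simp add: mat_trace_def dq_cnj_sum)
  finally show ?thesis
    by (simp add: dq_add_cnj)
qed

lemma unitary_ctranspose: "unitary_dqmat n U \<Longrightarrow> unitary_dqmat n (ctranspose U)"
  by (simp add: unitary_dqmat_def)

lemma unitary_mult:
  assumes U: "unitary_dqmat n U" and P: "unitary_dqmat n P"
  shows "unitary_dqmat n (U * P)"
proof -
  have c: "U \<in> carrier_mat n n" "P \<in> carrier_mat n n"
      "ctranspose U \<in> carrier_mat n n" "ctranspose P \<in> carrier_mat n n"
    using U P by (auto simp: unitary_dqmat_def)
  have "ctranspose P * ctranspose U * (U * P) = ctranspose P * (ctranspose U * U * P)"
    using assoc_mult_mat[OF c(4,3) mult_carrier_mat[OF c(1,2)]] assoc_mult_mat[OF c(3,1,2)]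
    by (simp only:)
  also have "\<dots> = 1\<^sub>m n"
    using U P left_mult_one_mat[OF c(2)]
    by (simp add: unitary_dqmat_def del: assoc_mult_mat)
  finally have left: "ctranspose P * ctranspose U * (U * P) = 1\<^sub>m n" .
  have "U * P * (ctranspose P * ctranspose U) = U * (P * ctranspose P * ctranspose U)"
    using assoc_mult_mat[OF c(1,2) mult_carrier_mat[OF c(4,3)]] assoc_mult_mat[OF c(2,4,3)]
    by (simp only:)
  also have "\<dots> = 1\<^sub>m n"
    using U P left_mult_one_mat[OF c(3)]
    by (simp add: unitary_dqmat_def del: assoc_mult_mat)
  finally have right: "U * P * (ctranspose P * ctranspose U) = 1\<^sub>m n" .
  show ?thesis
    unfolding unitary_dqmat_def ctranspose_mult[OF c(1,2)]
    using mult_carrier_mat[OF c(1,2)] left right by blast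
qed

text \<open>The diagonal entries of \<open>U * ctranspose U = 1\<close> are the row sums.\<close>

lemma unitary_row_sum:
  assumes U: "unitary_dqmat n U" and i: "i < n"
  shows "(\<Sum>j<n. dq_norm2 (U $$ (i, j))) = 1"
proof -
  have c: "U \<in> carrier_mat n n"
    using U by (simp add: unitary_dqmat_def)
  have "(\<Sum>j<n. dq_norm2 (U $$ (i, j))) = dq_re ((U * ctranspose U) $$ (i, i))"
    using c i by (simp add: mult_mat_index[OF c ctranspose_carrier[OF c]] dq_re_sum dq_norm2_def
        del: index_mult_mat)
  also have "\<dots> = 1"
    using U i by (simp add: unitary_dqmat_def)
  finally show ?thesis .
qed

lemma unitary_col_sum:
  assumes U: "unitary_dqmat n U" and j: "j < n"
  shows "(\<Sum>i<n. dq_norm2 (U $$ (i, j))) = 1"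
proof -
  have "U \<in> carrier_mat n n"
    using U by (simp add: unitary_dqmat_def)
  with unitary_row_sum[OF unitary_ctranspose[OF U] j] j show ?thesis
    by (simp add: dq_norm2_cnj)
qed

text \<open>
  Cutting a unitary matrix down to a leading block turns its squared moduli from doubly stochastic
  weights into doubly substochastic ones, as the discarded squared moduli are nonnegative.
\<close>

lemma unitary_form_le:
  fixes x y :: "nat \<Rightarrow> real dual"
  assumes U: "unitary_dqmat m U" and sm: "s \<le> m"
    and x: "\<And>i. i < s \<Longrightarrow> 0 \<le> x i" "\<And>i. Suc i < s \<Longrightarrow> x (Suc i) \<le> x i"
    and y: "\<And>i. i < s \<Longrightarrow> 0 \<le> y i" "\<And>i. Suc i < s \<Longrightarrow> y (Suc i) \<le> y i"
  shows "(\<Sum>i<s. \<Sum>j<s. x i * y j * dq_norm2 (U $$ (i, j))) \<le> (\<Sum>i<s. x i * y i)"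
proof (rule substochastic_form_le[where x = x and y = y, OF x y])
  fix i assume i: "i < s"
  have "(\<Sum>j<s. dq_norm2 (U $$ (i, j))) \<le> (\<Sum>j<m. dq_norm2 (U $$ (i, j)))"
    using sm by (intro sum_mono2) (auto simp: dq_norm2_nonneg)
  then show "(\<Sum>j<s. dq_norm2 (U $$ (i, j))) \<le> 1"
    using unitary_row_sum[OF U] i sm by simp
  have "(\<Sum>j<s. dq_norm2 (U $$ (j, i))) \<le> (\<Sum>j<m. dq_norm2 (U $$ (j, i)))"
    using sm by (intro sum_mono2) (auto simp: dq_norm2_nonneg)
  then show "(\<Sum>j<s. dq_norm2 (U $$ (j, i))) \<le> 1"
    using unitary_col_sum[OF U] i sm by simp
qed (auto simp: dq_norm2_nonneg)

section \<open>The trace inequality\<close>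

lemma dq_diag_carrier [simp]: "dq_diag m n \<sigma> \<in> carrier_mat m n"
  by (simp add: dq_diag_def)

lemma ctranspose_dq_diag: "ctranspose (dq_diag m n \<sigma>) = dq_diag n m \<sigma>"
  by (rule eq_matI) (auto simp: ctranspose_def dq_diag_def)

lemma dq_diag_mult_index:
  assumes X: "X \<in> carrier_mat n k" and "i < m" "j < k"
  shows "(dq_diag m n \<sigma> * X) $$ (i, j) = (if i < n then dq_of_dual (\<sigma> i) * X $$ (i, j) else 0)"
proof -
  have "(dq_diag m n \<sigma> * X) $$ (i, j)
      = (\<Sum>l<n. if i = l then dq_of_dual (\<sigma> l) * X $$ (l, j) else 0)"
    unfolding mult_mat_index[OF dq_diag_carrier X assms(2,3)]
    by (rule sum.cong) (use assms in \<open>auto simp: dq_diag_def\<close>)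
  then show ?thesis
    by simp
qed

lemma re_trace_product_of_diagonals:
  assumes W: "W \<in> carrier_mat m m" and Z: "Z \<in> carrier_mat n n"
  shows "dq_re (mat_trace ((dq_diag n m \<sigma> * W) * (dq_diag m n \<gamma> * Z)))
    = (\<Sum>i<min m n. \<Sum>j<min m n. \<sigma> i * \<gamma> j * dq_re (W $$ (i, j) * Z $$ (j, i)))"
proof -
  have term_eq: "dq_re (dq_of_dual a * w * (dq_of_dual b * z)) = a * b * dq_re (w * z)"
    for a b w z
    by (metis dq_of_dual_commute dq_re_scale mult.assoc)
  have "dq_re (mat_trace ((dq_diag n m \<sigma> * W) * (dq_diag m n \<gamma> * Z)))
    = (\<Sum>i<n. \<Sum>j<m. if i < m \<and> j < n
        then \<sigma> i * \<gamma> j * dq_re (W $$ (i, j) * Z $$ (j, i)) else 0)"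
    unfolding mat_trace_mult[OF mult_carrier_mat[OF dq_diag_carrier W]
        mult_carrier_mat[OF dq_diag_carrier Z]] dq_re_sum
    by (intro sum.cong refl)
       (simp add: dq_diag_mult_index[OF W] dq_diag_mult_index[OF Z] term_eq del: index_mult_mat)
  also have "\<dots> = (\<Sum>i<min m n. \<Sum>j<m. if i < m \<and> j < n
        then \<sigma> i * \<gamma> j * dq_re (W $$ (i, j) * Z $$ (j, i)) else 0)"
    by (rule sum.mono_neutral_right) (auto intro!: sum.neutral)
  also have "\<dots> = (\<Sum>i<min m n. \<Sum>j<min m n. if i < m \<and> j < n
        then \<sigma> i * \<gamma> j * dq_re (W $$ (i, j) * Z $$ (j, i)) else 0)"
    by (intro sum.cong refl sum.mono_neutral_right) auto
  also have "\<dots> = (\<Sum>i<min m n. \<Sum>j<min m n.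
      \<sigma> i * \<gamma> j * dq_re (W $$ (i, j) * Z $$ (j, i)))"
    by (intro sum.cong refl) auto
  finally show ?thesis .
qed

text \<open>Cyclic invariance moves the factor \<open>V\<close> to the end, where it meets \<open>Q\<^sup>*\<close>.\<close>

lemma re_trace_svd_product:
  assumes U: "U \<in> carrier_mat m m" and V: "V \<in> carrier_mat n n"
    and P: "P \<in> carrier_mat m m" and Q: "Q \<in> carrier_mat n n"
  shows "dq_re (mat_trace (ctranspose (U * dq_diag m n \<sigma> * ctranspose V)
        * (P * dq_diag m n \<gamma> * ctranspose Q)))
    = dq_re (mat_trace ((dq_diag n m \<sigma> * (ctranspose U * P))
        * (dq_diag m n \<gamma> * (ctranspose Q * V))))"
proof -
  let ?S = "dq_diag n m \<sigma>" and ?G = "dq_diag m n \<gamma>"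
  have U': "ctranspose U \<in> carrier_mat m m" and Q': "ctranspose Q \<in> carrier_mat n n"
    using U Q by auto
  let ?R = "?S * (ctranspose U * P) * (?G * ctranspose Q)"
  have UP: "ctranspose U * P \<in> carrier_mat m m"
    using U' P by simp
  have SUP: "?S * (ctranspose U * P) \<in> carrier_mat n m"
    by (rule mult_carrier_mat[OF dq_diag_carrier UP])
  have GQ: "?G * ctranspose Q \<in> carrier_mat m n"
    by (rule mult_carrier_mat[OF dq_diag_carrier Q'])
  have R: "?R \<in> carrier_mat n n"
    by (rule mult_carrier_mat[OF SUP GQ])
  have SU: "?S * ctranspose U \<in> carrier_mat n m"
    by (rule mult_carrier_mat[OF dq_diag_carrier U'])
  have "ctranspose (U * dq_diag m n \<sigma> * ctranspose V) = V * (?S * ctranspose U)"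
    by (simp add: ctranspose_mult[OF mult_carrier_mat[OF U dq_diag_carrier] ctranspose_carrier[OF V]]
        ctranspose_mult[OF U dq_diag_carrier] ctranspose_dq_diag)
  moreover have "P * ?G * ctranspose Q = P * (?G * ctranspose Q)"
    by (rule assoc_mult_mat[OF P dq_diag_carrier Q'])
  moreover have "V * (?S * ctranspose U) * (P * (?G * ctranspose Q)) = V * ?R"
  proof -
    have "V * (?S * ctranspose U) * (P * (?G * ctranspose Q))
        = V * (?S * ctranspose U * (P * (?G * ctranspose Q)))"
      by (rule assoc_mult_mat[OF V SU mult_carrier_mat[OF P GQ]])
    also have "?S * ctranspose U * (P * (?G * ctranspose Q))
        = ?S * ctranspose U * P * (?G * ctranspose Q)"
      by (rule assoc_mult_mat[OF SU P GQ, symmetric])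
    also have "?S * ctranspose U * P = ?S * (ctranspose U * P)"
      by (rule assoc_mult_mat[OF dq_diag_carrier U' P])
    finally show ?thesis .
  qed
  moreover have "?R * V = ?S * (ctranspose U * P) * (?G * (ctranspose Q * V))"
    by (simp add: assoc_mult_mat[OF SUP GQ V] assoc_mult_mat[OF dq_diag_carrier Q' V])
  ultimately show ?thesis
    using re_trace_commute[OF V R] by simp
qed

theorem theorem4p4:
  fixes A B :: "quat dual mat" and \<sigma>A \<sigma>B :: "nat \<Rightarrow> real dual" and m n :: nat
  assumes "A \<in> carrier_mat m n" and "B \<in> carrier_mat m n"
    and "singular_values A \<sigma>A" and "singular_values B \<sigma>B"
  shows "\<exists>t :: real dual.
    mat_trace (ctranspose A * B + ctranspose B * A) = dq_of_dual t \<and>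
    t \<le> 2 * (\<Sum>i<min m n. \<sigma>A i * \<sigma>B i)"
proof -
  let ?s = "min m n" and ?X = "ctranspose A * B"
  have dims: "dim_row A = m" "dim_col A = n" "dim_row B = m" "dim_col B = n"
    using assms by auto
  obtain U V where U: "unitary_dqmat m U" and V: "unitary_dqmat n V"
    and A: "A = U * dq_diag m n \<sigma>A * ctranspose V"
    using assms(3) unfolding singular_values_def dims by blast
  obtain P Q where P: "unitary_dqmat m P" and Q: "unitary_dqmat n Q"
    and B: "B = P * dq_diag m n \<sigma>B * ctranspose Q"
    using assms(4) unfolding singular_values_def dims by blast
  have a: "0 \<le> \<sigma>A i" "Suc i < ?s \<Longrightarrow> \<sigma>A (Suc i) \<le> \<sigma>A i" if "i < ?s" for i
    using assms(3) that unfolding singular_values_def dims by auto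
  have b: "0 \<le> \<sigma>B i" "Suc i < ?s \<Longrightarrow> \<sigma>B (Suc i) \<le> \<sigma>B i" if "i < ?s" for i
    using assms(4) that unfolding singular_values_def dims by auto
  define W where "W = ctranspose U * P"
  define Z where "Z = ctranspose Q * V"
  have W: "unitary_dqmat m W" and Z: "unitary_dqmat n Z"
    unfolding W_def Z_def using U V P Q by (auto intro: unitary_mult unitary_ctranspose)
  define T where "T = dq_re (mat_trace ?X)"
  have T: "T = (\<Sum>i<?s. \<Sum>j<?s. \<sigma>A i * \<sigma>B j * dq_re (W $$ (i, j) * Z $$ (j, i)))"
    unfolding T_def A B W_def Z_def
    using U V P Q W Z
    by (simp add: unitary_dqmat_def re_trace_svd_product
        re_trace_product_of_diagonals W_def[symmetric] Z_def[symmetric])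
  have "T + T = (\<Sum>i<?s. \<Sum>j<?s. \<sigma>A i * \<sigma>B j *
      (dq_re (W $$ (i, j) * Z $$ (j, i)) + dq_re (W $$ (i, j) * Z $$ (j, i))))"
    by (simp only: T distrib_left sum.distrib)
  also have "\<dots> \<le> (\<Sum>i<?s. \<Sum>j<?s. \<sigma>A i * \<sigma>B j *
      (dq_norm2 (W $$ (i, j)) + dq_norm2 (Z $$ (j, i))))"
    using a b by (intro sum_mono mult_left_mono two_re_mult_le mult_nonneg_nonneg) auto
  also have "\<dots> = (\<Sum>i<?s. \<Sum>j<?s. \<sigma>A i * \<sigma>B j * dq_norm2 (W $$ (i, j)))
      + (\<Sum>i<?s. \<Sum>j<?s. \<sigma>B i * \<sigma>A j * dq_norm2 (Z $$ (i, j)))"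
    by (subst (3) sum.swap) (simp add: distrib_left sum.distrib mult.commute)
  also have "\<dots> \<le> (\<Sum>i<?s. \<sigma>A i * \<sigma>B i) + (\<Sum>i<?s. \<sigma>B i * \<sigma>A i)"
    using a b by (intro add_mono unitary_form_le[OF W] unitary_form_le[OF Z]) auto
  finally have "T + T \<le> 2 * (\<Sum>i<?s. \<sigma>A i * \<sigma>B i)"
    unfolding mult_2 by (simp only: mult.commute)
  moreover have "mat_trace (?X + ctranspose B * A) = dq_of_dual (T + T)"
  proof -
    have "ctranspose ?X = ctranspose B * A"
      using ctranspose_mult[OF ctranspose_carrier[OF assms(1)] assms(2)] by simp
    moreover have "?X \<in> carrier_mat n n"
      using ctranspose_carrier[OF assms(1)] assms(2) by simp
    ultimately show ?thesis
      unfolding T_def using trace_add_ctranspose by metis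
  qed
  ultimately show ?thesis
    by blast
qed

end
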